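(* Let $A\in\mathbb{R}^{m\times n}$ have full row rank, let $b\in\mathbb{R}^m$, and suppose $\{x\in\mathbb{R}^n_+ : Ax=b\}\neq\emptyset$. Let $\mathcal{P}_{A,b}=\{y\in\mathbb{R}^n : A(y\circ y)=b\}$, and for $y\in\mathcal{P}_{A,b}$ let $\mathcal{M}(y)=\{z\in\mathcal{P}_{A,b} : z\sim y\}$ be its equivalence class under the relation of sharing the same regular representation. Then there are finitely many equivalence classes $\mathcal{M}(y)$ in $\mathcal{P}_{A,b}$. Each of them is a Riemannian manifold in $\mathbb{R}^n$ (with the Euclidean metric), and if $(M,N,r)$ is a regular representation of $y$ then $$\mathcal{M}(y)=\left\{z\in\mathbb{R}^n : MA(z\circ z)=Mb,\ \mathrm{rank}(MAD_z)=r,\ \mathrm{supp}(z)\subset\mathcal{I}\right\},\qquad \mathcal{I}:=\bigcup_{z\sim y}\mathrm{supp}(z).$$ In addition, $\mathcal{M}(y)\cap\mathbb{R}^n_+$ is connected.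
   Context: $\circ$ denotes the entrywise (Hadamard) product, $D_y=\mathrm{Diag}(y)$, $\mathrm{supp}(z)=\{i : z_i\ne0\}$. Regular representation: for $y\in\mathcal{P}_{A,b}$, a triple $(M,N,r)$ is a regular representation of $y$ if $r=\mathrm{rank}(AD_y)$, $M\in\mathbb{R}^{r\times m}$ has rows forming a basis of $\mathrm{Range}[AD_y]\subset\mathbb{R}^m$, and $N\in\mathbb{R}^{(m-r)\times m}$ has rows forming a basis of the orthogonal complement of $\mathrm{Range}[AD_y]$ in $\mathbb{R}^m$ ($M$ or $N$ may have no rows). Equivalence: $y_1\sim y_2$ for $y_1,y_2\in\mathcal{P}_{A,b}$ if they share the same regular representation, i.e. a regular representation of one is also a regular representation of the other (equivalently $\mathrm{Range}[AD_{y_1}]=\mathrm{Range}[AD_{y_2}]$). "Riemannian manifold in $\mathbb{R}^n$" means a smooth embedded submanifold of $\mathbb{R}^n$ with the metric induced by the Euclidean inner product. *)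

theory Defs
  imports "HOL-Analysis.Analysis"
begin

subsection \<open>Smooth maps and embedded submanifolds of Euclidean space\<close>

text \<open>
  For an open set \<open>S\<close> this says that \<open>f\<close> is of class \<open>C\<^sup>k\<close> on \<open>S\<close>: all iterated directional
  derivatives of order at most \<open>k\<close> exist as Frechet derivatives and are continuous.
\<close>

primrec C_k_on :: "nat \<Rightarrow> 'a::real_normed_vector set \<Rightarrow> ('a \<Rightarrow> 'b::real_normed_vector) \<Rightarrow> bool"
where
  "C_k_on 0 S f \<longleftrightarrow> continuous_on S f"
| "C_k_on (Suc k) S f \<longleftrightarrow>
     (\<forall>x\<in>S. f differentiable (at x)) \<and>
     (\<forall>v. C_k_on k S (\<lambda>x. frechet_derivative f (at x) v))"

definition smooth_on :: "'a::real_normed_vector set \<Rightarrow> ('a \<Rightarrow> 'b::real_normed_vector) \<Rightarrow> bool"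
  where "smooth_on S f \<longleftrightarrow> (\<forall>k. C_k_on k S f)"

text \<open>
  Local slice charts: around each of its points, \<open>S\<close> is carried by a diffeomorphism between open
  sets of the ambient space onto an open piece of a \<open>k\<close>-dimensional linear subspace.
  (Up to a linear isomorphism the subspace is a coordinate subspace.)
\<close>

definition embedded_submanifold :: "nat \<Rightarrow> 'a::euclidean_space set \<Rightarrow> bool"
  where "embedded_submanifold k S \<longleftrightarrow>
    (\<forall>p\<in>S. \<exists>U (V::'a set) \<phi> \<psi> L.
        open U \<and> p \<in> U \<and> open V \<and>
        homeomorphism U V \<phi> \<psi> \<and> smooth_on U \<phi> \<and> smooth_on V \<psi> \<and>
        subspace L \<and> dim L = k \<and> \<phi> ` (S \<inter> U) = L \<inter> V)"

text \<open>
  A Riemannian manifold in Euclidean space is a smooth embedded submanifold; its metric is by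
  convention the restriction of the ambient inner product to the tangent spaces, so it is determined
  by the set and imposes no further condition. All components have the same dimension.
\<close>

definition riemannian_manifold_in :: "'a::euclidean_space set \<Rightarrow> bool"
  where "riemannian_manifold_in S \<longleftrightarrow> (\<exists>k. embedded_submanifold k S)"


subsection \<open>The squared-variable parametrization and its equivalence classes\<close>

definition Diag :: "real^'n \<Rightarrow> real^'n^'n"
  where "Diag y = (\<chi> i j. if i = j then y $ i else 0)"

definition supp :: "real^'n \<Rightarrow> 'n set"
  where "supp z = {i. z $ i \<noteq> 0}"

definition nonneg_orthant :: "(real^'n) set"
  where "nonneg_orthant = {x. \<forall>i. 0 \<le> x $ i}"

text \<open>The product \<open>y * y\<close> on \<open>real^'n\<close> is the entrywise (Hadamard) product.\<close>

definition param_set :: "real^'n^'m \<Rightarrow> real^'m \<Rightarrow> (real^'n) set"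
  where "param_set A b = {y. A *v (y * y) = b}"

text \<open>
  A matrix whose number of rows varies and may be zero is given by the list of its rows. The
  operations below are its product with a vector, its product with a matrix, and its rank; the rank
  is the dimension of the row space, as in the definition of \<^const>\<open>rank\<close>.
\<close>

definition rows_mult_vec :: "(real^'m) list \<Rightarrow> real^'m \<Rightarrow> real list"
  where "rows_mult_vec M v = map (\<lambda>u. u \<bullet> v) M"

definition rows_mult_mat :: "(real^'m) list \<Rightarrow> real^'n^'m \<Rightarrow> (real^'n) list"
  where "rows_mult_mat M B = map (\<lambda>u. u v* B) M"

definition rows_rank :: "(real^'n) list \<Rightarrow> nat"
  where "rows_rank M = dim (set M)"

definition rows_form_basis :: "(real^'m) list \<Rightarrow> (real^'m) set \<Rightarrow> bool"
  where "rows_form_basis M V \<longleftrightarrow> distinct M \<and> independent (set M) \<and> span (set M) = V"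

definition regular_rep ::
    "real^'n^'m \<Rightarrow> real^'n \<Rightarrow> (real^'m) list \<Rightarrow> (real^'m) list \<Rightarrow> nat \<Rightarrow> bool"
  where "regular_rep A y M N r \<longleftrightarrow>
    r = rank (A ** Diag y) \<and>
    length M = r \<and> rows_form_basis M (range ((*v) (A ** Diag y))) \<and>
    length N = CARD('m) - r \<and> rows_form_basis N (orthogonal_comp (range ((*v) (A ** Diag y))))"

definition rep_equiv :: "real^'n^'m \<Rightarrow> real^'m \<Rightarrow> real^'n \<Rightarrow> real^'n \<Rightarrow> bool"
  where "rep_equiv A b y z \<longleftrightarrow>
    y \<in> param_set A b \<and> z \<in> param_set A b \<and>
    (\<exists>M N r. regular_rep A y M N r \<and> regular_rep A z M N r)"

definition equiv_class :: "real^'n^'m \<Rightarrow> real^'m \<Rightarrow> real^'n \<Rightarrow> (real^'n) set"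
  where "equiv_class A b y = {z \<in> param_set A b. rep_equiv A b z y}"

end

(*
  The range of A D_z is the span of the columns of A indexed by supp z, so the class of y consists of
  the solutions of A(z o z) = b whose active columns span the same subspace W as those of y. There are
  only finitely many supports. Having active columns that span W is an open condition among the z
  supported in the union of the supports of the class, and there the equation can be solved for the
  squares of the coordinates belonging to a basis of W, which gives explicit formulas (polynomials and
  square roots) for a slice chart, without the implicit function theorem. On the nonnegative orthant, x = z o z identifies the
  class with a convex set.
*)
theory Submission
  imports Defs
begin

section \<open>Calculus of smooth maps\<close>

lemma C_k_on_SucD:
  assumes "C_k_on (Suc k) S f" "x \<in> S"
  shows "(f has_derivative frechet_derivative f (at x)) (at x)"
  using assms frechet_derivative_works by auto

text \<open>Openness of \<open>S\<close> turns pointwise equality into equality near each point, so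
  the Frechet derivatives agree and the induction passes to them.\<close>

lemma C_k_on_cong:
  assumes "open S" "\<And>x. x \<in> S \<Longrightarrow> f x = g x" "C_k_on k S f"
  shows "C_k_on k S g"
  using assms(2,3)
proof (induction k arbitrary: f g)
  case 0
  then show ?case using continuous_on_cong[of S S f g] by auto
next
  case (Suc k)
  have g: "(g has_derivative frechet_derivative f (at x)) (at x)" if "x \<in> S" for x
    using has_derivative_transform_within_open[OF C_k_on_SucD[OF Suc.prems(2) that] \<open>open S\<close> that]
      Suc.prems(1) by auto
  then have eq: "frechet_derivative f (at x) = frechet_derivative g (at x)" if "x \<in> S" for x
    using that frechet_derivative_at by blast
  show ?case
    using g Suc.prems Suc.IH[of "\<lambda>x. frechet_derivative f (at x) v" "\<lambda>x. frechet_derivative g (at x) v" for v]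
    by (auto simp: eq differentiable_def)
qed

text \<open>Uniqueness of the derivative allows an explicit formula \<open>f'\<close> in place of
  the chosen \<open>frechet_derivative\<close>.\<close>

lemma C_k_on_SucI:
  assumes "open S" "\<And>x. x \<in> S \<Longrightarrow> (f has_derivative f' x) (at x)"
    and "\<And>v. C_k_on k S (\<lambda>x. f' x v)"
  shows "C_k_on (Suc k) S f"
proof -
  have "f' x = frechet_derivative f (at x)" if "x \<in> S" for x
    using assms(2)[OF that] frechet_derivative_at by blast
  then have "C_k_on k S (\<lambda>x. frechet_derivative f (at x) v)" for v
    by (intro C_k_on_cong[OF \<open>open S\<close> _ assms(3)]) auto
  then show ?thesis
    using assms(2) by (auto simp: differentiable_def)
qed

text \<open>The recursion lists only differentiability and the directional derivatives; lower orders
  follow by induction, starting from differentiable implies continuous.\<close>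

lemma C_k_on_Suc_imp:
  assumes "C_k_on (Suc k) S f"
  shows "C_k_on k S f"
  using assms
proof (induction k arbitrary: f)
  case 0
  then show ?case
    by (auto intro!: continuous_at_imp_continuous_on differentiable_imp_continuous_within)
next
  case (Suc k)
  then show ?case by (metis C_k_on.simps(2))
qed

lemma C_k_on_const: "open S \<Longrightarrow> C_k_on k S (\<lambda>x. c)"
  by (induction k arbitrary: c) (auto intro!: C_k_on_SucI[where f' = "\<lambda>x v. 0"] simp del: C_k_on.simps(2))

lemma C_k_on_add:
  assumes "open S" "C_k_on k S f" "C_k_on k S g"
  shows "C_k_on k S (\<lambda>x. f x + g x)"
  using assms(2,3)
proof (induction k arbitrary: f g)
  case 0
  then show ?case by (auto intro: continuous_on_add)
next
  case (Suc k)
  show ?case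
  proof (rule C_k_on_SucI[OF \<open>open S\<close>])
    show "((\<lambda>x. f x + g x) has_derivative
        (\<lambda>v. frechet_derivative f (at x) v + frechet_derivative g (at x) v)) (at x)" if "x \<in> S" for x
      by (intro has_derivative_add C_k_on_SucD[OF Suc.prems(1) that] C_k_on_SucD[OF Suc.prems(2) that])
  qed (use Suc in auto)
qed

lemma C_k_on_bounded_linear_compose:
  assumes "open S" "bounded_linear h" "C_k_on k S f"
  shows "C_k_on k S (\<lambda>x. h (f x))"
  using assms(3)
proof (induction k arbitrary: f)
  case 0
  then show ?case using bounded_linear.continuous_on[OF assms(2)] by auto
next
  case (Suc k)
  show ?case
  proof (rule C_k_on_SucI[OF \<open>open S\<close>])
    show "((\<lambda>x. h (f x)) has_derivative (\<lambda>v. h (frechet_derivative f (at x) v))) (at x)"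
      if "x \<in> S" for x
      by (intro bounded_linear.has_derivative[OF assms(2)] C_k_on_SucD[OF Suc.prems that])
  qed (use Suc in auto)
qed

lemma C_k_on_bounded_bilinear:
  assumes "open S" "bounded_bilinear pr" "C_k_on k S f" "C_k_on k S g"
  shows "C_k_on k S (\<lambda>x. pr (f x) (g x))"
  using assms(3,4)
proof (induction k arbitrary: f g)
  case 0
  then show ?case using bounded_bilinear.continuous_on[OF assms(2)] by auto
next
  case (Suc k)
  show ?case
  proof (rule C_k_on_SucI[OF \<open>open S\<close>])
    show "((\<lambda>x. pr (f x) (g x)) has_derivative
        (\<lambda>v. pr (f x) (frechet_derivative g (at x) v) + pr (frechet_derivative f (at x) v) (g x))) (at x)"
      if "x \<in> S" for x
      by (intro bounded_bilinear.FDERIV[OF assms(2)] C_k_on_SucD[OF Suc.prems(1) that] C_k_on_SucD[OF Suc.prems(2) that])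
    show "C_k_on k S (\<lambda>x. pr (f x) (frechet_derivative g (at x) v) + pr (frechet_derivative f (at x) v) (g x))"
      for v
      using Suc.prems
      \<comment> \<open>Each summand pairs one undifferentiated factor with one derivative, so the
        former must first be lowered from order \<open>Suc k\<close> to \<open>k\<close>.\<close>
      by (intro C_k_on_add[OF \<open>open S\<close>] Suc.IH) (use C_k_on_Suc_imp in auto)
  qed
qed

text \<open>Real powers form a family closed under differentiation up to products: the derivative
  involves \<open>f\<close> to the power \<open>a - 1\<close>. Hence the induction keeps
  \<open>a\<close> arbitrary; \<open>a = 1/2\<close> gives square roots.\<close>

lemma C_k_on_powr:
  fixes f :: "'a::real_normed_vector \<Rightarrow> real"
  assumes "open S" "\<And>x. x \<in> S \<Longrightarrow> f x > 0" "C_k_on k S f"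
  shows "C_k_on k S (\<lambda>x. f x powr a)"
  using assms(3)
proof (induction k arbitrary: a)
  case 0
  then show ?case
    by (auto intro!: continuous_on_powr simp: less_imp_neq[THEN not_sym] assms(2))
next
  case (Suc k)
  show ?case
  proof (rule C_k_on_SucI[OF \<open>open S\<close>])
    show "((\<lambda>x. f x powr a) has_derivative
        (\<lambda>v. a * (frechet_derivative f (at x) v * f x powr (a - 1)))) (at x)"
      if "x \<in> S" for x
      using assms(2)[OF that]
      by (auto intro!: derivative_eq_intros C_k_on_SucD[OF Suc.prems that] ext
          simp: powr_diff field_simps)
    show "C_k_on k S (\<lambda>x. a * (frechet_derivative f (at x) v * f x powr (a - 1)))" for v
      using Suc.prems C_k_on_Suc_imp[OF Suc.prems]
      by (intro C_k_on_bounded_bilinear[OF \<open>open S\<close> bounded_bilinear_mult] C_k_on_const[OF \<open>open S\<close>] Suc.IH)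
        auto
  qed
qed

section \<open>Closure properties of smooth maps\<close>

lemma smooth_on_cong:
  "\<lbrakk>open S; \<And>x. x \<in> S \<Longrightarrow> f x = g x; smooth_on S f\<rbrakk> \<Longrightarrow> smooth_on S g"
  using C_k_on_cong unfolding smooth_on_def by blast

lemma smooth_on_const: "open S \<Longrightarrow> smooth_on S (\<lambda>x. c)"
  by (simp add: smooth_on_def C_k_on_const)

lemma smooth_on_bounded_linear:
  assumes "open S" "bounded_linear h"
  shows "smooth_on S h"
  unfolding smooth_on_def
proof
  show "C_k_on k S h" for k
  proof (cases k)
    case 0
    then show ?thesis using linear_continuous_on[OF assms(2)] by simp
  next
    case (Suc n)
    then show ?thesis
      using C_k_on_SucI[OF assms(1) bounded_linear_imp_has_derivative[OF assms(2)]
          C_k_on_const[OF assms(1)]] by simp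
  qed
qed

lemma smooth_on_add:
  "\<lbrakk>open S; smooth_on S f; smooth_on S g\<rbrakk> \<Longrightarrow> smooth_on S (\<lambda>x. f x + g x)"
  by (simp add: smooth_on_def C_k_on_add)

lemma smooth_on_sum:
  assumes "open S" "\<And>i. i \<in> I \<Longrightarrow> smooth_on S (f i)"
  shows "smooth_on S (\<lambda>x. \<Sum>i\<in>I. f i x)"
  using assms(2)
  by (induction I rule: infinite_finite_induct) (auto intro: assms(1) smooth_on_const smooth_on_add)

lemma smooth_on_mult:
  fixes f g :: "'a::real_normed_vector \<Rightarrow> 'b::real_normed_algebra"
  shows "\<lbrakk>open S; smooth_on S f; smooth_on S g\<rbrakk> \<Longrightarrow> smooth_on S (\<lambda>x. f x * g x)"
  by (simp add: smooth_on_def C_k_on_bounded_bilinear[OF _ bounded_bilinear_mult])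

lemma smooth_on_bounded_linear_compose:
  "\<lbrakk>open S; bounded_linear h; smooth_on S f\<rbrakk> \<Longrightarrow> smooth_on S (\<lambda>x. h (f x))"
  by (simp add: smooth_on_def C_k_on_bounded_linear_compose)

lemma smooth_on_diff:
  assumes "open S" "smooth_on S f" "smooth_on S g"
  shows "smooth_on S (\<lambda>x. f x - g x)"
  using smooth_on_add[OF assms(1,2)
      smooth_on_bounded_linear_compose[OF assms(1) bounded_linear_minus[OF bounded_linear_ident] assms(3)]]
  by simp

lemma smooth_on_sqrt:
  assumes "open S" "\<And>x. x \<in> S \<Longrightarrow> f x > 0" "smooth_on S f"
  shows "smooth_on S (\<lambda>x. sqrt (f x))"
proof (rule smooth_on_cong[OF \<open>open S\<close>])
  show "f x powr (1/2) = sqrt (f x)" if "x \<in> S" for x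
    using assms(2)[OF that] by (simp add: powr_half_sqrt)
  show "smooth_on S (\<lambda>x. f x powr (1/2))"
    using C_k_on_powr[OF assms(1,2)] assms(3) by (simp add: smooth_on_def)
qed

lemma smooth_on_vec_nth: "open S \<Longrightarrow> smooth_on S (\<lambda>x::real^'n. x $ i)"
  by (simp add: smooth_on_bounded_linear bounded_linear_vec_nth)

lemma smooth_on_vec_lambda:
  fixes f :: "'n::finite \<Rightarrow> 'a::real_normed_vector \<Rightarrow> real"
  assumes "open S" "\<And>i. smooth_on S (f i)"
  shows "smooth_on S (\<lambda>x. \<chi> i. f i x)"
proof (rule smooth_on_cong[OF \<open>open S\<close>])
  \<comment> \<open>Expanding in the standard basis reduces the vector-valued map to a finite sum of
    smooth terms.\<close>
  show "(\<Sum>i\<in>UNIV. f i x *\<^sub>R axis i 1) = (\<chi> i. f i x)" for x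
    by (simp add: vec_eq_iff axis_def if_distrib cong: if_cong)
  show "smooth_on S (\<lambda>x. \<Sum>i\<in>UNIV. f i x *\<^sub>R (axis i 1 :: real^'n))"
    by (intro smooth_on_sum smooth_on_bounded_linear_compose[OF _ bounded_linear_scaleR_left] assms)
qed

lemma smooth_on_imp_continuous_on: "smooth_on S f \<Longrightarrow> continuous_on S f"
  unfolding smooth_on_def by (drule spec[of _ 0]) simp


section \<open>Classes as column spans\<close>

lemma mult_vec_in_span_columns:
  fixes A :: "real^'n^'m"
  assumes "supp x \<subseteq> I"
  shows "A *v x \<in> span ((\<lambda>i. column i A) ` I)"
proof -
  have "x $ i *s column i A \<in> span ((\<lambda>i. column i A) ` I)" for i
    using assms
    by (cases "i \<in> I"; cases "x $ i = 0")
      (auto simp: supp_def scalar_mult_eq_scaleR subset_iff span_zero intro: span_scale[OF span_base])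
  then show ?thesis
    unfolding matrix_mult_sum by (intro span_sum)
qed

text \<open>Since \<open>(A ** Diag z) *v x = A *v (z * x)\<close>, only columns indexed by
  \<open>supp z\<close> contribute, and each of them is attained.\<close>

lemma range_mult_Diag:
  fixes A :: "real^'n^'m"
  shows "range ((*v) (A ** Diag z)) = span ((\<lambda>i. column i A) ` supp z)"
proof -
  have Diag: "Diag z *v x = z * x" for x
    by (simp add: vec_eq_iff matrix_vector_mult_def Diag_def if_distrib if_distribR cong: if_cong)
  then have eq: "(A ** Diag z) *v x = A *v (z * x)" for x
    by (simp flip: matrix_vector_mul_assoc)
  show ?thesis
  proof
    show "range ((*v) (A ** Diag z)) \<subseteq> span ((\<lambda>i. column i A) ` supp z)"
      using mult_vec_in_span_columns[of "z * x" "supp z" A for x] by (auto simp: eq supp_def)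
    have "column i A \<in> range ((*v) (A ** Diag z))" if "i \<in> supp z" for i
    proof -
      \<comment> \<open>Dividing by the nonzero entry \<open>z $ i\<close> gives a preimage of
        column \<open>i\<close>.\<close>
      have "z * axis i (1 / z $ i) = axis i 1"
        using that by (simp add: vec_eq_iff axis_def supp_def)
      then show ?thesis
        by (metis eq matrix_vector_mult_basis rangeI)
    qed
    then show "span ((\<lambda>i. column i A) ` supp z) \<subseteq> range ((*v) (A ** Diag z))"
      by (intro span_minimal linear_subspace_image subspace_UNIV) auto
  qed
qed

lemma supp_square [simp]: "supp (z * z) = supp z"
  by (simp add: supp_def)

section \<open>Regular representations and finiteness of the set of classes\<close>

lemma rows_form_basis_exists:
  assumes "subspace V"
  obtains M where "rows_form_basis M V" "length M = dim V"
proof -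
  obtain B where B: "B \<subseteq> V" "independent B" "V \<subseteq> span B" "card B = dim V"
    using basis_exists by blast
  then obtain M where "set M = B" "distinct M"
    using finite_distinct_list independent_imp_finite by metis
  with B that show thesis
    using assms by (metis distinct_card rows_form_basis_def span_subspace)
qed

lemma dim_orthogonal_comp:
  fixes V :: "(real^'m) set"
  assumes "subspace V"
  shows "dim (orthogonal_comp V) = CARD('m) - dim V"
proof -
  have "orthogonal_comp V = {y \<in> UNIV. \<forall>x\<in>V. orthogonal x y}"
    by (auto simp: orthogonal_comp_def)
  then show ?thesis
    using dim_subspace_orthogonal_to_vectors[OF assms subspace_UNIV] by simp
qed

text \<open>Supplies the witnesses for the existential in \<open>rep_equiv\<close> when two ranges
  coincide.\<close>

lemma regular_rep_exists:
  fixes A :: "real^'n^'m"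
  obtains M N where "regular_rep A y M N (rank (A ** Diag y))"
proof -
  let ?R = "range ((*v) (A ** Diag y))"
  have R: "subspace ?R"
    by (intro linear_subspace_image subspace_UNIV) auto
  obtain M where "rows_form_basis M ?R" "length M = dim ?R"
    using rows_form_basis_exists[OF R] .
  moreover obtain N where "rows_form_basis N (orthogonal_comp ?R)" "length N = dim (orthogonal_comp ?R)"
    using rows_form_basis_exists[OF subspace_orthogonal_comp] .
  ultimately show thesis
    using that by (auto simp: regular_rep_def rank_dim_range dim_orthogonal_comp[OF R])
qed

text \<open>The rows of \<open>M\<close> span the range and so determine it; conversely
  \<open>regular_rep\<close> depends on \<open>y\<close> only through that range, the rank being its
  dimension.\<close>

lemma rep_equiv_iff:
  "rep_equiv A b y z \<longleftrightarrow> y \<in> param_set A b \<and> z \<in> param_set A b \<and>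
     span ((\<lambda>i. column i A) ` supp y) = span ((\<lambda>i. column i A) ` supp z)"
proof -
  have "(\<exists>M N r. regular_rep A y M N r \<and> regular_rep A z M N r) \<longleftrightarrow>
      range ((*v) (A ** Diag y)) = range ((*v) (A ** Diag z))" (is "?L \<longleftrightarrow> ?R")
  proof
    show ?R if ?L
      using that by (auto simp: regular_rep_def rows_form_basis_def)
    assume ?R
    obtain M N where "regular_rep A y M N (rank (A ** Diag y))"
      by (rule regular_rep_exists)
    with \<open>?R\<close> show ?L
      unfolding regular_rep_def rank_dim_range by metis
  qed
  then show ?thesis
    by (simp add: rep_equiv_def range_mult_Diag)
qed

lemma equiv_class_eq:
  assumes "y \<in> param_set A b"
  shows "equiv_class A b y = {z. A *v (z * z) = b \<and>
    span ((\<lambda>i. column i A) ` supp z) = span ((\<lambda>i. column i A) ` supp y)}"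
  using assms by (auto simp: equiv_class_def rep_equiv_iff param_set_def)

lemma finite_equiv_classes:
  fixes A :: "real^'n^'m"
  shows "finite (equiv_class A b ` param_set A b)"
proof -
  \<comment> \<open>A class depends on \<open>y\<close> only through \<open>supp y\<close>, one of
    finitely many index sets \<open>J\<close>.\<close>
  let ?C = "\<lambda>J. {z. A *v (z * z) = b \<and>
    span ((\<lambda>i. column i A) ` supp z) = span ((\<lambda>i. column i A) ` J)}"
  have "equiv_class A b ` param_set A b \<subseteq> range ?C"
    using equiv_class_eq by blast
  then show ?thesis
    by (rule finite_subset) simp
qed

section \<open>Description of a class by a regular representation\<close>

text \<open>The map \<open>u \<mapsto> u v* B\<close> kills the orthogonal complement of the range of \<open>B\<close>, so its rank on
  \<open>W\<close> cannot exceed the dimension of that range.\<close>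

lemma rows_rank_mult_mat_eq_iff:
  fixes B :: "real^'n^'m"
  assumes M: "rows_form_basis M W" and sub: "range ((*v) B) \<subseteq> W"
  shows "rows_rank (rows_mult_mat M B) = dim W \<longleftrightarrow> range ((*v) B) = W"
proof -
  let ?f = "\<lambda>u. u v* B"
  have lin: "linear ?f"
    using matrix_vector_mul_linear[of "transpose B"] by (simp flip: transpose_matrix_vector)
  have W: "subspace W" "span (set M) = W"
    using M by (auto simp: rows_form_basis_def)
  have R: "subspace (range ((*v) B))"
    by (intro linear_subspace_image subspace_UNIV) auto
  have rank: "rows_rank (rows_mult_mat M B) = dim (?f ` W)"
    using dim_span[of "?f ` set M"] linear_span_image[OF lin, of "set M"] W(2)
    by (simp add: rows_rank_def rows_mult_mat_def)
  \<comment> \<open>The kernel of \<open>?f\<close> is the orthogonal complement of the range of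
    \<open>B\<close>.\<close>
  have ker: "?f u = 0 \<longleftrightarrow> (\<forall>x. u \<bullet> (B *v x) = 0)" for u
  proof -
    have "?f u = 0 \<longleftrightarrow> (\<forall>x. ?f u \<bullet> x = 0)"
      using inner_eq_zero_iff[of "?f u"] by (auto simp del: inner_eq_zero_iff)
    then show ?thesis
      unfolding dot_lmul_matrix .
  qed
  show ?thesis
  proof
    assume "rows_rank (rows_mult_mat M B) = dim W"
    moreover have "?f ` W \<subseteq> ?f ` range ((*v) B)"
    proof clarify
      fix u
      \<comment> \<open>The component \<open>w\<close> orthogonal to the range is killed, so
        \<open>u\<close> and its projection \<open>v\<close> have the same image.\<close>
      obtain v w where vw: "v \<in> span (range ((*v) B))"
          "\<And>x. x \<in> span (range ((*v) B)) \<Longrightarrow> orthogonal w x" "u = v + w"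
        using orthogonal_subspace_decomp_exists by blast
      have "?f w = 0"
        unfolding ker using vw(2) span_base by (metis orthogonal_def rangeI)
      then show "?f u \<in> ?f ` range ((*v) B)"
        using vw(1,3) R linear_add[OF lin] by (auto simp: span_eq_iff[THEN iffD2])
    qed
    ultimately have "dim W \<le> dim (range ((*v) B))"
      using rank dim_subset dim_image_le[OF lin] by (metis order_trans)
    then show "range ((*v) B) = W"
      using subspace_dim_equal[OF R W(1) sub] by simp
  next
    assume eq: "range ((*v) B) = W"
    \<comment> \<open>Here \<open>u\<close> lies in the range of \<open>B\<close> and is orthogonal
      to it, hence to itself.\<close>
    have "u = 0" if "u \<in> W" "?f u = 0" for u
      using that eq ker[of u] inner_eq_zero_iff[of u] by blast
    then have "inj_on ?f (span W)"
      using linear_injective_on_subspace_0[OF lin W(1)] W(1) by (simp add: span_eq_iff[THEN iffD2])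
    then show "rows_rank (rows_mult_mat M B) = dim W"
      using rank dim_image_eq[OF lin] by simp
  qed
qed

text \<open>The difference \<open>v - w\<close> lies in the span of the rows and is orthogonal to
  all of them, so it vanishes.\<close>

lemma rows_mult_vec_eq_iff:
  assumes "rows_form_basis M W" "v \<in> W" "w \<in> W"
  shows "rows_mult_vec M v = rows_mult_vec M w \<longleftrightarrow> v = w"
proof
  assume "rows_mult_vec M v = rows_mult_vec M w"
  then have "\<forall>u\<in>set M. orthogonal (v - w) u"
    by (simp add: rows_mult_vec_def orthogonal_def inner_commute inner_diff_left inner_diff_right)
  moreover have "v - w \<in> span (set M)"
    using assms subspace_diff subspace_span by (metis rows_form_basis_def)
  ultimately show "v = w"
    using orthogonal_to_span[of "v - w" "set M" "v - w"] by (auto simp: orthogonal_self)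
qed auto

lemma rows_mult_vec_mult_mat:
  "rows_mult_vec (rows_mult_mat M A) x = rows_mult_vec M (A *v x)"
  by (simp add: rows_mult_vec_def rows_mult_mat_def dot_lmul_matrix)

lemma rows_mult_mat_assoc:
  "rows_mult_mat (rows_mult_mat M A) B = rows_mult_mat M (A ** B)"
  by (simp add: rows_mult_mat_def vector_matrix_mul_assoc)

text \<open>The support condition confines the range of \<open>A ** Diag z\<close> and the vector
  \<open>A *v (z * z)\<close> to \<open>W\<close>. There the rows of \<open>M\<close> detect
  equality of vectors, and the rank detects whether the range fills \<open>W\<close>.\<close>

lemma equiv_class_regular_rep:
  fixes A :: "real^'n^'m"
  assumes y: "y \<in> param_set A b" and rep: "regular_rep A y M N r"
  shows "equiv_class A b y =
    {z. rows_mult_vec (rows_mult_mat M A) (z * z) = rows_mult_vec M b \<and>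
        rows_rank (rows_mult_mat (rows_mult_mat M A) (Diag z)) = r \<and>
        supp z \<subseteq> (\<Union>w \<in> {w. rep_equiv A b w y}. supp w)}" (is "_ = ?R")
proof -
  let ?c = "\<lambda>i. column i A"
  define W where "W = span (?c ` supp y)"
  define I where "I = (\<Union>w \<in> {w. rep_equiv A b w y}. supp w)"
  have M: "rows_form_basis M W" and r: "r = dim W"
    using rep by (auto simp: regular_rep_def rank_dim_range range_mult_Diag W_def)
  \<comment> \<open>Every index in \<open>I\<close> is active in some member of the class, whose
    active columns span \<open>W\<close>.\<close>
  have I: "?c ` I \<subseteq> W"
  proof clarify
    fix i assume "i \<in> I"
    then obtain w where "i \<in> supp w" "span (?c ` supp w) = W"
      by (auto simp: I_def rep_equiv_iff W_def)
    then show "?c i \<in> W"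
      using span_base[of "?c i" "?c ` supp w"] by auto
  qed
  have b: "b \<in> W"
    using y mult_vec_in_span_columns[of "y * y" "supp y" A] by (auto simp: param_set_def W_def)
  have span: "span (?c ` supp z) \<subseteq> W" if "supp z \<subseteq> I" for z
    using that I unfolding W_def by (intro span_minimal) (auto simp: subset_iff)
  have Az: "A *v (z * z) \<in> W" if "supp z \<subseteq> I" for z
    using mult_vec_in_span_columns[of "z * z" "supp z" A] span[OF that] by auto
  have rank: "rows_rank (rows_mult_mat (rows_mult_mat M A) (Diag z)) = r \<longleftrightarrow> span (?c ` supp z) = W"
    if "supp z \<subseteq> I" for z
    using rows_rank_mult_mat_eq_iff[OF M] span[OF that]
    unfolding range_mult_Diag[symmetric] rows_mult_mat_assoc r by auto
  have vec: "rows_mult_vec (rows_mult_mat M A) (z * z) = rows_mult_vec M b \<longleftrightarrow> A *v (z * z) = b"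
    if "supp z \<subseteq> I" for z
    using rows_mult_vec_eq_iff[OF M Az[OF that] b] by (simp add: rows_mult_vec_mult_mat)
  have "supp z \<subseteq> I" if "z \<in> equiv_class A b y" for z
    using that by (auto simp: equiv_class_def I_def)
  then have "equiv_class A b y =
      {z. A *v (z * z) = b \<and> span (?c ` supp z) = W \<and> supp z \<subseteq> I}"
    unfolding equiv_class_eq[OF y] W_def by auto
  also have "\<dots> = ?R"
    unfolding I_def[symmetric] using rank vec by auto
  finally show ?thesis .
qed

section \<open>Connectedness of the nonnegative part\<close>

text \<open>The entrywise square root is continuous, and in squared coordinates the class is convex: a
  proper convex combination of nonnegative vectors is supported on the union of their supports.\<close>

lemma connected_equiv_class_nonneg:
  fixes A :: "real^'n^'m"
  assumes y: "y \<in> param_set A b"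
  shows "connected (equiv_class A b y \<inter> nonneg_orthant)"
proof -
  let ?c = "\<lambda>i. column i A"
  define W where "W = span (?c ` supp y)"
  define X where "X = {x \<in> nonneg_orthant. A *v x = b \<and> span (?c ` supp x) = W}"
  define root where "root x = (\<chi> i. sqrt (x $ i))" for x :: "real^'n"
  have "convex X"
  proof (rule convexI)
    fix x x' :: "real^'n" and s t :: real
    assume x: "x \<in> X" and x': "x' \<in> X" and st: "0 \<le> s" "0 \<le> t" "s + t = 1"
    show "s *\<^sub>R x + t *\<^sub>R x' \<in> X"
    \<comment> \<open>With a zero weight the support is that of one endpoint only, so this case is
      separate.\<close>
    proof (cases "s = 0 \<or> t = 0")
      case True
      with st x x' show ?thesis by auto
    next
      case False
      with st have pos: "s > 0" "t > 0" by auto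
      have nn: "x $ i \<ge> 0" "x' $ i \<ge> 0" for i
        using x x' by (auto simp: X_def nonneg_orthant_def)
      have "s * x $ i + t * x' $ i = 0 \<longleftrightarrow> x $ i = 0 \<and> x' $ i = 0" for i
        using pos nn[of i] by (simp add: add_nonneg_eq_0_iff)
      then have "supp (s *\<^sub>R x + t *\<^sub>R x') = supp x \<union> supp x'"
        by (auto simp: supp_def)
      moreover have "span (?c ` supp x \<union> ?c ` supp x') = W"
      proof
        have W: "span (?c ` supp x) = W" "span (?c ` supp x') = W"
          using x x' by (auto simp: X_def)
        then show "span (?c ` supp x \<union> ?c ` supp x') \<subseteq> W"
          using span_superset[of "?c ` supp x"] span_superset[of "?c ` supp x'"]
          by (intro span_minimal) (auto simp: W_def)
        show "W \<subseteq> span (?c ` supp x \<union> ?c ` supp x')"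
          unfolding W(1)[symmetric] by (intro span_mono) auto
      qed
      moreover have "A *v (s *\<^sub>R x + t *\<^sub>R x') = b"
        using x x' st by (simp add: X_def matrix_vector_right_distrib matrix_vector_mult_scaleR
          flip: scaleR_left_distrib)
      ultimately show ?thesis
        using nn pos by (auto simp: X_def nonneg_orthant_def image_Un)
    qed
  qed
  then have "connected (root ` X)"
    unfolding root_def
    by (intro connected_continuous_image convex_connected continuous_intros)
  moreover have "equiv_class A b y \<inter> nonneg_orthant = root ` X"
  proof (intro set_eqI iffI)
    fix z
    assume z: "z \<in> equiv_class A b y \<inter> nonneg_orthant"
    \<comment> \<open>The root of a square is the absolute value, so nonnegativity makes
      \<open>root\<close> undo squaring.\<close>
    then have "root (z * z) = z"
      by (simp add: root_def vec_eq_iff nonneg_orthant_def)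
    moreover have "z * z \<in> X"
      using z y by (auto simp: X_def W_def equiv_class_eq nonneg_orthant_def)
    ultimately show "z \<in> root ` X" by (metis imageI)
  next
    fix z
    assume "z \<in> root ` X"
    then obtain x where x: "x \<in> X" "z = root x" by blast
    then have "z * z = x"
      by (simp add: root_def vec_eq_iff X_def nonneg_orthant_def)
    moreover from this have "supp z = supp x"
      using supp_square[of z] by simp
    ultimately show "z \<in> equiv_class A b y \<inter> nonneg_orthant"
      using x y by (auto simp: equiv_class_eq X_def W_def nonneg_orthant_def root_def)
  qed
  ultimately show ?thesis by simp
qed


section \<open>The classes as submanifolds\<close>

text \<open>Fixing the sign \<open>s i\<close> of each coordinate in \<open>B\<close> makes squaring
  invertible with a smooth inverse. The shift \<open>q i\<close> depends only on coordinates off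
  \<open>B\<close>, which both maps leave fixed, so it can be subtracted again.\<close>

lemma square_chart:
  fixes B :: "'n::finite set" and q :: "'n \<Rightarrow> real^'n \<Rightarrow> real" and s :: "'n \<Rightarrow> real"
  defines "\<phi> \<equiv> \<lambda>z. \<chi> i. if i \<in> B then z $ i * z $ i + q i z else z $ i"
    and "\<psi> \<equiv> \<lambda>w. \<chi> i. if i \<in> B then s i * sqrt (w $ i - q i w) else w $ i"
    and "U \<equiv> {z. \<forall>i\<in>B. s i * z $ i > 0}"
    and "V \<equiv> {w. \<forall>i\<in>B. w $ i - q i w > 0}"
  assumes s: "\<And>i. \<bar>s i\<bar> = 1"
    and smooth: "\<And>i S. open S \<Longrightarrow> smooth_on S (q i)"
    and indep: "\<And>i z w. (\<And>j. j \<notin> B \<Longrightarrow> z $ j = w $ j) \<Longrightarrow> q i z = q i w"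
  shows "open U" "open V" "homeomorphism U V \<phi> \<psi>" "smooth_on U \<phi>" "smooth_on V \<psi>"
proof -
  have U: "U = (\<Inter>i\<in>B. {z. s i * z $ i > 0})" and V: "V = (\<Inter>i\<in>B. {w. w $ i - q i w > 0})"
    by (auto simp: U_def V_def)
  have q: "continuous_on UNIV (q i)" for i
    using smooth[of UNIV] smooth_on_imp_continuous_on by blast
  show "open U"
    unfolding U by (intro open_INT ballI open_Collect_less continuous_intros) auto
  show "open V"
    unfolding V by (intro open_INT ballI open_Collect_less continuous_intros q) auto
  note smooth_intros = smooth_on_add smooth_on_diff smooth_on_mult smooth_on_const
    smooth_on_vec_nth smooth smooth_on_vec_lambda
  show \<phi>: "smooth_on U \<phi>"
    unfolding \<phi>_def
  proof (intro smooth_on_vec_lambda \<open>open U\<close>)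
    show "smooth_on U (\<lambda>z. if i \<in> B then z $ i * z $ i + q i z else z $ i)" for i
      using \<open>open U\<close> by (cases "i \<in> B") (auto intro!: smooth_intros)
  qed
  show \<psi>: "smooth_on V \<psi>"
    unfolding \<psi>_def
  proof (intro smooth_on_vec_lambda \<open>open V\<close>)
    show "smooth_on V (\<lambda>w. if i \<in> B then s i * sqrt (w $ i - q i w) else w $ i)" for i
      using \<open>open V\<close> by (cases "i \<in> B") (auto intro!: smooth_intros smooth_on_sqrt simp: V_def)
  qed
  have ss: "s i * s i = 1" for i
    using s[of i] by (metis abs_mult_self_eq mult_1)
  have q\<phi>: "q i (\<phi> z) = q i z" for i z
    by (rule indep) (simp add: \<phi>_def)
  have q\<psi>: "q i (\<psi> w) = q i w" for i w
    by (rule indep) (simp add: \<psi>_def)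
  \<comment> \<open>On \<open>U\<close> the absolute value of \<open>z $ i\<close> is
    \<open>s i * z $ i\<close>, and \<open>s i\<close> squares to 1.\<close>
  have s_sqrt: "s i * sqrt (z $ i * z $ i) = z $ i" if "z \<in> U" "i \<in> B" for z i
  proof -
    have "s i * \<bar>z $ i\<bar> = s i * (\<bar>s i\<bar> * \<bar>z $ i\<bar>)"
      by (simp add: s)
    also have "\<dots> = s i * (s i * z $ i)"
      using that by (simp add: U_def less_imp_le flip: abs_mult)
    also have "\<dots> = z $ i"
      using ss[of i] by (simp flip: mult.assoc)
    finally show ?thesis by simp
  qed
  have sq: "(\<psi> w $ i) * (\<psi> w $ i) = w $ i - q i w" if "w \<in> V" "i \<in> B" for w i
  proof -
    have "w $ i - q i w \<ge> 0"
      using that by (auto simp: V_def intro: less_imp_le)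
    then have "(s i * s i) * (sqrt (w $ i - q i w) * sqrt (w $ i - q i w)) = w $ i - q i w"
      by (simp only: ss real_sqrt_mult_self) simp
    then show ?thesis
      using that by (simp add: \<psi>_def mult.assoc mult.left_commute)
  qed
  have \<psi>\<phi>: "\<psi> (\<phi> z) = z" if "z \<in> U" for z
    using s_sqrt[OF that] unfolding vec_eq_iff \<psi>_def
    by (auto simp: q\<phi>) (auto simp: \<phi>_def)
  have \<phi>\<psi>: "\<phi> (\<psi> w) = w" if "w \<in> V" for w
    using sq[OF that] unfolding vec_eq_iff \<phi>_def
    by (auto simp: q\<psi>) (auto simp: \<psi>_def)
  show "homeomorphism U V \<phi> \<psi>"
  proof (rule homeomorphismI)
    show "\<phi> ` U \<subseteq> V"
    proof clarify
      fix z assume "z \<in> U"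
      then have "z $ i \<noteq> 0" if "i \<in> B" for i
        using that by (auto simp: U_def)
      then have "z $ i * z $ i > 0" if "i \<in> B" for i
        using that by (simp add: less_le)
      then show "\<phi> z \<in> V"
        by (simp add: V_def q\<phi>) (simp add: \<phi>_def)
    qed
    show "\<psi> ` V \<subseteq> U"
      using s by (auto simp: U_def V_def \<psi>_def ss simp flip: mult.assoc)
  qed (use \<phi> \<psi> \<phi>\<psi> \<psi>\<phi> smooth_on_imp_continuous_on in auto)
qed

text \<open>Near a point \<open>p\<close>, pick indices \<open>B\<close> in its support whose columns form a basis of \<open>W\<close>. In this
  basis the equation \<open>A (z * z) = b\<close> expresses the squares \<open>z\<^sub>i\<^sup>2\<close> for \<open>i \<in> B\<close> through the
  remaining coordinates, so \<open>square_chart\<close> flattens the set.\<close>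

lemma embedded_submanifold_square_fiber:
  fixes A :: "real^'n^'m"
  assumes I: "\<And>i. i \<in> I \<Longrightarrow> column i A \<in> W"
  shows "embedded_submanifold (card I - dim W)
    {z. supp z \<subseteq> I \<and> A *v (z * z) = b \<and> span ((\<lambda>i. column i A) ` supp z) = W}"
    (is "embedded_submanifold _ ?S")
  unfolding embedded_submanifold_def
proof
  fix p assume "p \<in> ?S"
  let ?c = "\<lambda>i. column i A"
  have p: "supp p \<subseteq> I" "A *v (p * p) = b" "span (?c ` supp p) = W"
    using \<open>p \<in> ?S\<close> by auto
  have W: "subspace W"
    using p(3) subspace_span by blast
  \<comment> \<open>Taking the basis among the active columns at \<open>p\<close> keeps
    \<open>p $ i\<close> nonzero for \<open>i\<close> in \<open>B\<close>, away from the singularity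
    of the square root.\<close>
  obtain B' where B': "B' \<subseteq> ?c ` supp p" "independent B'" "?c ` supp p \<subseteq> span B'"
    using maximal_independent_subset by blast
  then obtain B where B: "B \<subseteq> supp p" "inj_on ?c B" "B' = ?c ` B"
    using subset_image_inj by metis
  have span_B: "span (?c ` B) = W"
    using B' B(3) p(3) by (metis span_mono span_span subset_antisym)
  have card_B: "card B = dim W"
    using B' B span_B by (metis card_image dim_eq_card_independent dim_span)
  \<comment> \<open>On \<open>W\<close>, \<open>g\<close> reads off coordinates in the basis of
    columns indexed by \<open>B\<close>; it is some linear extension elsewhere.\<close>
  obtain g where g: "linear g" "\<And>i. i \<in> B \<Longrightarrow> g (?c i) = axis i (1::real)"
  proof -
    obtain g where "linear g" "\<forall>x\<in>B'. g x = axis (inv_into B ?c x) (1::real)"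
      using linear_independent_extend[OF B'(2), of "\<lambda>x. axis (inv_into B ?c x) (1::real)"] by blast
    then show thesis
      using B inv_into_f_f[OF B(2)] by (intro that[of g]) auto
  qed
  have expand: "w = (\<Sum>i\<in>B. (g w) $ i *\<^sub>R ?c i)" if "w \<in> W" for w
  proof -
    have lin: "linear (\<lambda>w. \<Sum>i\<in>B. (g w) $ i *\<^sub>R ?c i)"
      using g(1) by (auto intro!: linearI simp: linear_add linear_cmul algebra_simps sum.distrib scaleR_sum_right)
    have "?c j = (\<Sum>i\<in>B. g (?c j) $ i *\<^sub>R ?c i)" if "j \<in> B" for j
      using that g(2) by (simp add: axis_def if_distrib if_distribR cong: if_cong)
    then show ?thesis
      using linear_eq_on[OF linear_ident lin] that span_B by fastforce
  qed
  have inj: "v = w" if "v \<in> W" "w \<in> W" "\<And>i. i \<in> B \<Longrightarrow> g v $ i = g w $ i" for v w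
    using expand[OF that(1)] expand[OF that(2)] that(3) by simp
  \<comment> \<open>\<open>q i\<close> collects the terms off \<open>B\<close> and the constant, so
    coordinate \<open>i\<close> of the equation reads \<open>z $ i * z $ i + q i z = 0\<close>.
    Columns outside \<open>W\<close> have indices outside \<open>I\<close>, so their terms vanish
    when \<open>supp z\<close> lies in \<open>I\<close>.\<close>
  define q where "q i z = (\<Sum>j\<in>-B. g (?c j) $ i * (z $ j * z $ j)) - g b $ i" for i and z :: "real^'n"
  have q: "g (A *v (z * z)) $ i - g b $ i = z $ i * z $ i + q i z" if "i \<in> B" for i z
  proof -
    have "g (A *v (z * z)) = (\<Sum>j\<in>UNIV. (z $ j * z $ j) *\<^sub>R g (?c j))"
      unfolding matrix_mult_sum using g(1) by (simp add: linear_sum linear_cmul scalar_mult_eq_scaleR)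
    then have "g (A *v (z * z)) $ i = (\<Sum>j\<in>UNIV. g (?c j) $ i * (z $ j * z $ j))"
      by (simp add: mult.commute)
    also have "\<dots> = (\<Sum>j\<in>B. g (?c j) $ i * (z $ j * z $ j)) + (\<Sum>j\<in>-B. g (?c j) $ i * (z $ j * z $ j))"
      by (subst sum.union_disjoint[symmetric]) (auto intro!: sum.cong)
    also have "(\<Sum>j\<in>B. g (?c j) $ i * (z $ j * z $ j)) = (\<Sum>j\<in>B. if j = i then z $ i * z $ i else 0)"
      by (intro sum.cong) (auto simp: g(2) axis_def)
    finally show ?thesis
      using that by (simp add: q_def)
  qed
  \<comment> \<open>The signs of \<open>p\<close> put \<open>p\<close> into \<open>U\<close>; the
    default 1 at zero entries gives \<open>s i\<close> absolute value 1 for every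
    \<open>i\<close>.\<close>
  define s where "s i = (if p $ i < 0 then -1 else 1 :: real)" for i
  define \<phi> where "\<phi> = (\<lambda>z::real^'n. \<chi> i. if i \<in> B then z $ i * z $ i + q i z else z $ i)"
  define \<psi> where "\<psi> = (\<lambda>w::real^'n. \<chi> i. if i \<in> B then s i * sqrt (w $ i - q i w) else w $ i)"
  define U where "U = {z::real^'n. \<forall>i\<in>B. s i * z $ i > 0}"
  define V where "V = {w::real^'n. \<forall>i\<in>B. w $ i - q i w > 0}"
  have smooth_q: "smooth_on S (q i)" if "open S" for S i
    unfolding q_def using that
    by (intro smooth_on_diff smooth_on_sum smooth_on_mult smooth_on_const smooth_on_vec_nth)
  have "\<bar>s i\<bar> = 1" for i
    by (simp add: s_def)
  moreover have "q i z = q i w" if "\<And>j. j \<notin> B \<Longrightarrow> z $ j = w $ j" for i z w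
    using that by (simp add: q_def)
  ultimately have chart: "open U" "open V" "homeomorphism U V \<phi> \<psi>" "smooth_on U \<phi>" "smooth_on V \<psi>"
    using square_chart[of s q B] smooth_q unfolding U_def V_def \<phi>_def \<psi>_def by blast+
  \<comment> \<open>Vanishing on \<open>B\<close> encodes the equation and vanishing off
    \<open>I\<close> the support condition, leaving the coordinates in \<open>I - B\<close>
    free.\<close>
  define L where "L = {w::real^'n. \<forall>i. i \<notin> I - B \<longrightarrow> w $ i = 0}"
  have "subspace L"
    by (auto simp: L_def subspace_def)
  have dim_L: "dim L = card I - dim W"
    using dim_substandard_cart[of "I - B", where 'a = real] B(1) p(1) card_B
    by (simp add: L_def dim_vec_eq card_Diff_subset)
  have "p \<in> U"
    using B(1) by (auto simp: U_def s_def supp_def)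
  have mem: "z \<in> ?S \<longleftrightarrow> \<phi> z \<in> L" if "z \<in> U" for z
  proof -
    have B_z: "B \<subseteq> supp z"
      using that by (auto simp: U_def supp_def)
    \<comment> \<open>On \<open>U\<close> the indices in \<open>B\<close> stay active, so the span
      condition follows from the support condition alone.\<close>
    have "span (?c ` supp z) = W" if "supp z \<subseteq> I"
    proof
      show "span (?c ` supp z) \<subseteq> W"
        using that I by (intro span_minimal W) auto
      show "W \<subseteq> span (?c ` supp z)"
        using B_z span_B by (metis image_mono span_mono)
    qed
    moreover have "A *v (z * z) = b \<longleftrightarrow> (\<forall>i\<in>B. \<phi> z $ i = 0)" if "supp z \<subseteq> I"
    proof -
      have "A *v (z * z) \<in> W" "b \<in> W"
        using mult_vec_in_span_columns[of "z * z" "supp z" A] mult_vec_in_span_columns[of "p * p" "supp p" A]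
          calculation[OF that] p by auto
      then have "A *v (z * z) = b \<longleftrightarrow> (\<forall>i\<in>B. g (A *v (z * z)) $ i - g b $ i = 0)"
        using inj[of "A *v (z * z)" b] by auto
      also have "\<dots> \<longleftrightarrow> (\<forall>i\<in>B. \<phi> z $ i = 0)"
        by (intro ball_cong) (simp_all add: q \<phi>_def)
      finally show ?thesis .
    qed
    \<comment> \<open>Indices outside \<open>I\<close> lie outside \<open>B\<close>, where
      \<open>\<phi>\<close> changes nothing.\<close>
    moreover have "supp z \<subseteq> I \<longleftrightarrow> (\<forall>i. i \<notin> I \<longrightarrow> \<phi> z $ i = 0)"
      using B(1) p(1) by (auto simp: supp_def \<phi>_def)
    ultimately show ?thesis
      by (auto simp: L_def)
  qed
  have "\<phi> ` (?S \<inter> U) = L \<inter> V"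
  proof
    show "\<phi> ` (?S \<inter> U) \<subseteq> L \<inter> V"
      using mem homeomorphism_image1[OF chart(3)] by blast
    show "L \<inter> V \<subseteq> \<phi> ` (?S \<inter> U)"
      using mem homeomorphism_image1[OF chart(3)] by blast
  qed
  then show "\<exists>U (V::(real^'n) set) \<phi> \<psi> L. open U \<and> p \<in> U \<and> open V \<and>
      homeomorphism U V \<phi> \<psi> \<and> smooth_on U \<phi> \<and> smooth_on V \<psi> \<and>
      subspace L \<and> dim L = card I - dim W \<and> \<phi> ` (?S \<inter> U) = L \<inter> V"
    using chart \<open>p \<in> U\<close> \<open>subspace L\<close> dim_L by blast
qed

text \<open>With \<open>I\<close> the union of all supports in the class, adding
  \<open>supp z\<close> in \<open>I\<close> leaves the class unchanged, and the dimension
  \<open>card I - dim W\<close>, with \<open>W\<close> the common column span, is the same at every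
  point.\<close>

lemma riemannian_manifold_in_equiv_class:
  fixes A :: "real^'n^'m"
  assumes y: "y \<in> param_set A b"
  shows "riemannian_manifold_in (equiv_class A b y)"
proof -
  let ?c = "\<lambda>i. column i A"
  define I where "I = (\<Union>z \<in> equiv_class A b y. supp z)"
  have "?c i \<in> span (?c ` supp y)" if i: "i \<in> I" for i
  proof -
    obtain w where "i \<in> supp w" "span (?c ` supp w) = span (?c ` supp y)"
      using i by (auto simp: I_def equiv_class_eq[OF y])
    then show ?thesis
      using span_base[of "?c i" "?c ` supp w"] by auto
  qed
  then have "embedded_submanifold (card I - dim (span (?c ` supp y)))
      {z. supp z \<subseteq> I \<and> A *v (z * z) = b \<and> span (?c ` supp z) = span (?c ` supp y)}"
    by (rule embedded_submanifold_square_fiber)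
  moreover have "equiv_class A b y =
      {z. supp z \<subseteq> I \<and> A *v (z * z) = b \<and> span (?c ` supp z) = span (?c ` supp y)}"
    unfolding I_def by (auto simp: equiv_class_eq[OF y])
  ultimately show ?thesis
    unfolding riemannian_manifold_in_def by auto
qed

theorem proposition6:
  fixes A :: "real^'n^'m" and b :: "real^'m"
  assumes full_row_rank: "rank A = CARD('m)"
    and feasible: "{x \<in> nonneg_orthant. A *v x = b} \<noteq> {}"
  shows "finite (equiv_class A b ` param_set A b) \<and>
    (\<forall>y \<in> param_set A b.
        riemannian_manifold_in (equiv_class A b y) \<and>
        (\<forall>M N r. regular_rep A y M N r \<longrightarrow>
            equiv_class A b y =
              {z. rows_mult_vec (rows_mult_mat M A) (z * z) = rows_mult_vec M b \<and>
                  rows_rank (rows_mult_mat (rows_mult_mat M A) (Diag z)) = r \<and>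
                  supp z \<subseteq> (\<Union>w \<in> {w. rep_equiv A b w y}. supp w)}) \<and>
        connected (equiv_class A b y \<inter> nonneg_orthant))"
  by (intro conjI ballI allI impI finite_equiv_classes riemannian_manifold_in_equiv_class
      equiv_class_regular_rep connected_equiv_class_nonneg)

end
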